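(* Let $q,a,b,c,d$ be complex numbers with $0<|q|<1$ and $a,c,d\neq 0$, such that none of $a$, $b$, $cq/a$, $dq/a$, $cdq/a$ belongs to $\{q^{-m}: m=0,1,2,\dots\}$ (so that no denominator below vanishes). Then \begin{align*} \sum_{n=0}^\infty & \frac{(c,d;q)_n\,(abq^{n-1};q)_{n}\,q^n}{(q,a,b;q)_n}\\ &=\frac{(q/a,cdq/a;q)_\infty}{(cq/a,dq/a;q)_\infty} \sum_{n=0}^\infty \frac{(c,d,cq/a,dq/a;q)_n\,b^nq^{n^2}}{(q,b;q)_n\,(cdq/a;q)_{2n}}\\ &\quad+\frac{q}{a}\,\frac{(c,d;q)_\infty}{(q,a;q)_\infty} \sum_{n=0}^\infty \frac{b^nq^{n^2}}{(q,b;q)_n} \left(\sum_{k=0}^\infty \frac{(q^{1-n}/c,q^{1-n}/d;q)_k\,q^{k^2+2nk+2k}\,(1-q^{2k+2}/a)}{(cq^{n+1}/a,dq^{n+1}/a;q)_{k+1}}\Big(\frac{cd}{a^2}\Big)^k\right). \end{align*}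
   Context: For a complex number $q$ with $|q|<1$: $(x;q)_0=1$, $(x;q)_n=(1-x)(1-xq)\cdots(1-xq^{n-1})$ for $n\ge 1$, and $(x;q)_\infty=\prod_{n=0}^\infty(1-xq^n)$. For $n$ a nonnegative integer or $n=\infty$, $(x_1,\dots,x_m;q)_n=(x_1;q)_n\cdots(x_m;q)_n$. *)

theory Defs
  imports "HOL-Analysis.Analysis"
begin

definition qpoch :: "complex \<Rightarrow> complex \<Rightarrow> nat \<Rightarrow> complex" where
  "qpoch q x n = (\<Prod>i<n. 1 - x * q ^ i)"

definition qpoch_inf :: "complex \<Rightarrow> complex \<Rightarrow> complex" where
  "qpoch_inf q x = (\<Prod>i. 1 - x * q ^ i)"

(* qpochs q [x1,...,xm] n is (x1,...,xm;q)_n *)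
definition qpochs :: "complex \<Rightarrow> complex list \<Rightarrow> nat \<Rightarrow> complex" where
  "qpochs q xs n = (\<Prod>x\<leftarrow>xs. qpoch q x n)"

definition qpochs_inf :: "complex \<Rightarrow> complex list \<Rightarrow> complex" where
  "qpochs_inf q xs = (\<Prod>x\<leftarrow>xs. qpoch_inf q x)"

(* prodinf is only meaningful for convergent products; convergence here is in the sense of
   has_prod, which permits finitely many zero factors *)
lemma convergent_prod_qpoch:
  fixes q x :: complex
  assumes "norm q < 1"
  shows "convergent_prod (\<lambda>i. 1 - x * q ^ i)"
proof -
  have "summable (\<lambda>i. norm (- x * q ^ i))"
    using assms by (simp add: norm_mult norm_power summable_mult summable_geometric)
  then have "abs_convergent_prod (\<lambda>i. 1 + (- x * q ^ i))"
    by (simp add: abs_convergent_prod_conv_summable)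
  then show ?thesis
    by (simp add: abs_convergent_prod_imp_convergent_prod)
qed

lemma qpoch_tendsto_qpoch_inf:
  assumes "norm q < 1"
  shows "qpoch q x \<longlonglongrightarrow> qpoch_inf q x"
proof -
  have "(\<lambda>n. \<Prod>i\<le>n. 1 - x * q ^ i) \<longlonglongrightarrow> qpoch_inf q x"
    unfolding qpoch_inf_def by (rule convergent_prod_LIMSEQ[OF convergent_prod_qpoch[OF assms]])
  then have "(\<lambda>n. qpoch q x (Suc n)) \<longlonglongrightarrow> qpoch_inf q x"
    by (simp add: qpoch_def lessThan_Suc_atMost)
  then show ?thesis
    by (simp add: filterlim_sequentially_Suc)
qed

(* Exponents that may be negative (n - 1 at n = 0, and 1 - n) use the integer power powi. *)

definition lhs_term :: "complex \<Rightarrow> complex \<Rightarrow> complex \<Rightarrow> complex \<Rightarrow> complex \<Rightarrow> nat \<Rightarrow> complex" where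
  "lhs_term q a b c d n =
     qpochs q [c, d] n * qpoch q (a * b * q powi (int n - 1)) n * q ^ n / qpochs q [q, a, b] n"

definition rhs1_term :: "complex \<Rightarrow> complex \<Rightarrow> complex \<Rightarrow> complex \<Rightarrow> complex \<Rightarrow> nat \<Rightarrow> complex" where
  "rhs1_term q a b c d n =
     qpochs q [c, d, c * q / a, d * q / a] n * b ^ n * q ^ (n\<^sup>2)
       / (qpochs q [q, b] n * qpoch q (c * d * q / a) (2 * n))"

definition inner_term ::
    "complex \<Rightarrow> complex \<Rightarrow> complex \<Rightarrow> complex \<Rightarrow> nat \<Rightarrow> nat \<Rightarrow> complex" where
  "inner_term q a c d n k =
     qpochs q [q powi (1 - int n) / c, q powi (1 - int n) / d] k
       * q ^ (k\<^sup>2 + 2 * n * k + 2 * k) * (1 - q ^ (2 * k + 2) / a)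
       / qpochs q [c * q ^ (n + 1) / a, d * q ^ (n + 1) / a] (k + 1)
       * (c * d / a\<^sup>2) ^ k"

definition rhs2_term :: "complex \<Rightarrow> complex \<Rightarrow> complex \<Rightarrow> complex \<Rightarrow> complex \<Rightarrow> nat \<Rightarrow> complex" where
  "rhs2_term q a b c d n =
     b ^ n * q ^ (n\<^sup>2) / qpochs q [q, b] n * (\<Sum>k. inner_term q a c d n k)"

end

theory Submission
  imports Defs
begin

text \<open>
Write \<open>T(C, D, a) = \<Sum>\<^sub>m (C, D;q)\<^sub>m q\<^sup>m / (q, a;q)\<^sub>m\<close>, a \<open>2\<phi>1\<close> series with argument \<open>q\<close>.
The finite q-Vandermonde sum, in the form \<open>q_vandermonde\<close>, expands \<open>(abq^(n-1);q)\<^sub>n / (q, a, b;q)\<^sub>n\<close>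
as a sum over \<open>j \<le> n\<close> in which \<open>b\<close> occurs only with \<open>j\<close> and \<open>a\<close> only with \<open>n - j\<close>. Summing over the
diagonals \<open>n = j + m\<close> (\<open>sums_antidiagonal\<close>) turns the left-hand side into

\<open>\<Sum>\<^sub>j b\<^sup>j q^(j^2) (c, d;q)\<^sub>j / (q, b;q)\<^sub>j * T(c q\<^sup>j, d q\<^sup>j, a)\<close>,

so the theorem follows, coefficient by coefficient in \<open>b\<^sup>j q^(j^2) / (q, b;q)\<^sub>j\<close>, from an evaluation
of \<open>T\<close>, which is \<open>nonterminating_q_vandermonde\<close>: up to infinite products, \<open>T(C, D, a)\<close> is a product plus
a multiple of the series \<open>S(1/a)\<close> that appears, with \<open>C = c q\<^sup>n\<close> and \<open>D = d q\<^sup>n\<close>, as the inner sum of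
the second term on the right.

That evaluation cannot simply be quoted from the usual nonterminating q-Vandermonde sum, whose second
\<open>2\<phi>1\<close> has denominator parameter \<open>q\<^sup>2/a\<close> and breaks down when \<open>a\<close> is a positive power of \<open>q\<close>.
The proof works instead with \<open>\<Phi>(a) = (a;q)\<^sub>\<infinity> T(C, D, a)\<close>, which extends to every \<open>a\<close>.
Both \<open>\<Phi>\<close> and \<open>S\<close> satisfy a first-order inhomogeneous recurrence under \<open>a \<mapsto> a/q\<close>, each obtained by
telescoping (\<open>phi_recurrence\<close>, \<open>vwp_recurrence\<close>), and the inhomogeneities match: the difference
\<open>F(a) = \<Phi>(a) - (q/a) (C, D;q)\<^sub>\<infinity> / (q;q)\<^sub>\<infinity> * S(1/a)\<close> satisfies a homogeneous one,

\<open>F(a) = - (q/a) (1 - CDq/a) / ((1 - Cq/a) (1 - Dq/a)) * F(a/q)\<close>.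

Iterating it \<open>N\<close> times and letting \<open>N\<close> tend to infinity evaluates \<open>F\<close> as a product. In the limit only the
term \<open>m = 0\<close> of \<open>\<Phi>(a/q\<^sup>N)\<close> survives (\<open>phi_limit\<close>, by dominated convergence for series), and the
contribution of \<open>S\<close> vanishes.
\<close>

section \<open>Shifted factorials\<close>

text \<open>For \<open>q \<noteq> 0\<close> this says that \<open>x\<close> is not of the form \<open>q\<^sup>-\<^sup>m\<close>; it is the condition under which no
\<open>(x;q)\<^sub>n\<close> vanishes, and it is inherited by \<open>x q\<^sup>n\<close>.\<close>

definition qregular :: "complex \<Rightarrow> complex \<Rightarrow> bool" where
  "qregular q x \<longleftrightarrow> (\<forall>m. x * q ^ m \<noteq> 1)"

lemma qpoch_0 [simp]: "qpoch q x 0 = 1"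
  by (simp add: qpoch_def)

lemma qpoch_Suc: "qpoch q x (Suc n) = qpoch q x n * (1 - x * q ^ n)"
  by (simp add: qpoch_def)

lemma qpoch_add: "qpoch q x (m + n) = qpoch q x m * qpoch q (x * q ^ m) n"
  by (induction n) (simp_all add: qpoch_Suc power_add mult.assoc)

lemma qpoch_Suc_left: "qpoch q x (Suc n) = (1 - x) * qpoch q (x * q) n"
  using qpoch_add[of q x 1 n] by (simp add: qpoch_Suc)

lemma qregular_shift: "qregular q x \<Longrightarrow> qregular q (x * q ^ n)"
  by (auto simp: qregular_def mult.assoc simp flip: power_add)

lemma qregularD: "qregular q x \<Longrightarrow> 1 - x * q ^ m \<noteq> 0"
  by (simp add: qregular_def eq_commute[of 1])

lemma qpoch_nonzero: "qregular q x \<Longrightarrow> qpoch q x n \<noteq> 0"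
  using qregularD[of q x] by (auto simp: qpoch_def)

lemma qregular_base: "norm q < 1 \<Longrightarrow> qregular q q"
  unfolding qregular_def
  by (metis norm_one norm_power order_less_irrefl power_Suc power_less_one_iff zero_less_Suc norm_ge_zero)

context
  fixes q :: complex
  assumes q1: "norm q < 1"
begin

lemma qpoch_inf_split: "qpoch_inf q x = qpoch q x n * qpoch_inf q (x * q ^ n)"
proof -
  have "(\<lambda>k. qpoch q x (k + n)) \<longlonglongrightarrow> qpoch_inf q x"
    by (intro LIMSEQ_ignore_initial_segment qpoch_tendsto_qpoch_inf q1)
  moreover have "(\<lambda>k. qpoch q x (k + n)) \<longlonglongrightarrow> qpoch q x n * qpoch_inf q (x * q ^ n)"
    unfolding add.commute[of _ n] qpoch_add
    by (intro tendsto_intros qpoch_tendsto_qpoch_inf q1)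
  ultimately show ?thesis
    by (rule LIMSEQ_unique)
qed

lemma qpoch_inf_nonzero: "qregular q x \<Longrightarrow> qpoch_inf q x \<noteq> 0"
  unfolding qpoch_inf_def
  by (intro prodinf_nonzero convergent_prod_qpoch q1) (auto dest: qregularD)

text \<open>An estimate uniform in \<open>n\<close> and explicit in \<open>x\<close>. It gives both the boundedness of the shifted factorials
on discs and the continuity of \<open>(x;q)\<^sub>\<infinity>\<close> at \<open>x = 0\<close>.\<close>

lemma norm_qpoch_minus_1_le: "norm (qpoch q x n - 1) \<le> exp (norm x / (1 - norm q)) - 1"
proof -
  have "norm (qpoch q x n - 1) \<le> (\<Prod>i<n. 1 + norm (- x * q ^ i)) - 1"
    using norm_prod_minus1_le_prod_minus1[of "\<lambda>i. - x * q ^ i" "{..<n}"]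
    by (simp add: qpoch_def)
  also have "(\<Prod>i<n. 1 + norm (- x * q ^ i)) \<le> exp (\<Sum>i<n. norm (- x * q ^ i))"
    by (rule prod_le_exp_sum) simp
  also have "(\<Sum>i<n. norm (- x * q ^ i)) = norm x * (\<Sum>i<n. norm q ^ i)"
    by (simp add: norm_mult norm_power sum_distrib_left)
  also have "(\<Sum>i<n. norm q ^ i) \<le> (\<Sum>i. norm q ^ i)"
    using q1 by (intro sum_le_suminf summable_geometric) auto
  also have "\<dots> = 1 / (1 - norm q)"
    using q1 by (simp add: suminf_geometric)
  finally show ?thesis
    by (simp add: mult_left_mono)
qed

lemma norm_qpoch_le: "norm (qpoch q x n) \<le> exp (norm x / (1 - norm q))"
  using norm_qpoch_minus_1_le[of x n] norm_triangle_ineq[of "qpoch q x n - 1" 1] by simp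

lemma norm_qpoch_inf_le: "norm (qpoch_inf q x) \<le> exp (norm x / (1 - norm q))"
  by (rule LIMSEQ_le_const2[OF tendsto_norm[OF qpoch_tendsto_qpoch_inf[OF q1]]])
     (use norm_qpoch_le in blast)

lemma norm_qpoch_inf_le_mono: "norm x \<le> R \<Longrightarrow> norm (qpoch_inf q x) \<le> exp (R / (1 - norm q))"
  by (rule order.trans[OF norm_qpoch_inf_le]) (use q1 in \<open>simp add: divide_right_mono\<close>)

lemma norm_power_q_le_1: "norm (q ^ n) \<le> 1"
  using q1 by (simp add: norm_power power_le_one)

lemma norm_shift_le: "norm (x * q ^ n) \<le> norm x"
  using norm_power_q_le_1[of n] by (simp add: norm_mult mult_left_le)

lemma qpoch_inf_shift_tendsto_1: "(\<lambda>n. qpoch_inf q (x * q ^ n)) \<longlonglongrightarrow> 1"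
proof -
  have "norm (qpoch_inf q y - 1) \<le> exp (norm y / (1 - norm q)) - 1" for y
    by (rule LIMSEQ_le_const2[OF tendsto_norm[OF tendsto_diff[OF qpoch_tendsto_qpoch_inf[OF q1] tendsto_const]]])
       (use norm_qpoch_minus_1_le in blast)
  then have bound: "norm (qpoch_inf q (x * q ^ n) - 1) \<le> exp (norm (x * q ^ n) / (1 - norm q)) - 1" for n .
  have "(\<lambda>n. exp (norm (x * q ^ n) / (1 - norm q)) - 1) \<longlonglongrightarrow> exp (norm (x * 0) / (1 - norm q)) - 1"
    using q1 by (intro tendsto_intros LIMSEQ_power_zero) auto
  then have "(\<lambda>n. exp (norm (x * q ^ n) / (1 - norm q)) - 1) \<longlonglongrightarrow> 0"
    by simp
  then have "(\<lambda>n. qpoch_inf q (x * q ^ n) - 1) \<longlonglongrightarrow> 0"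
    by (rule Lim_null_comparison[OF always_eventually, rotated]) (use bound in blast)
  then show ?thesis
    by (simp add: LIM_zero_iff)
qed

text \<open>Since \<open>(xq\<^sup>n;q)\<^sub>k = (x;q)\<^sub>n\<^sub>+\<^sub>k / (x;q)\<^sub>n\<close> and \<open>(x;q)\<^sub>n\<close> stays bounded and bounded away from \<open>0\<close>, one
constant serves all \<open>n\<close> and \<open>k\<close>. The uniformity in \<open>n\<close> is what controls the inner sums simultaneously.\<close>

lemma inverse_qpoch_bounded:
  assumes "qregular q x"
  obtains K where "K > 0" "\<And>n k. norm (inverse (qpoch q (x * q ^ n) k)) \<le> K"
proof -
  have "convergent (\<lambda>n. inverse (qpoch q x n))"
    using tendsto_inverse[OF qpoch_tendsto_qpoch_inf[OF q1] qpoch_inf_nonzero[OF assms]]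
    by (auto simp: convergent_def)
  then obtain L where L: "L > 0" "\<And>n. norm (inverse (qpoch q x n)) \<le> L"
    by (meson Bseq_def convergent_imp_Bseq)
  show thesis
  proof
    fix n k
    have "inverse (qpoch q (x * q ^ n) k) = qpoch q x n * inverse (qpoch q x (n + k))"
      using qpoch_nonzero[OF assms] by (simp add: qpoch_add)
    also have "norm \<dots> \<le> exp (norm x / (1 - norm q)) * L"
      unfolding norm_mult by (intro mult_mono norm_qpoch_le L) auto
    finally show "norm (inverse (qpoch q (x * q ^ n) k)) \<le> exp (norm x / (1 - norm q)) * L" .
  qed (use L in simp)
qed

lemma summable_power_mult_gauss:
  fixes M :: real
  assumes "M \<ge> 0"
  shows "summable (\<lambda>k. M ^ k * norm q ^ k\<^sup>2)"
proof (rule summable_comparison_test_ev)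
  have "(\<lambda>k. M * norm q ^ k) \<longlonglongrightarrow> M * 0"
    using q1 by (intro tendsto_intros LIMSEQ_power_zero) auto
  then have "eventually (\<lambda>k. M * norm q ^ k < 1 / 2) sequentially"
    by (rule order_tendstoD) simp
  then show "eventually (\<lambda>k. norm (M ^ k * norm q ^ k\<^sup>2) \<le> (1 / 2) ^ k) sequentially"
  proof eventually_elim
    case (elim k)
    have "norm (M ^ k * norm q ^ k\<^sup>2) = (M * norm q ^ k) ^ k"
      using assms by (simp add: power_mult_distrib power2_eq_square power_mult abs_mult)
    also have "\<dots> \<le> (1 / 2) ^ k"
      using elim assms by (intro power_mono) auto
    finally show ?case .
  qed
qed (simp add: summable_geometric)

end

section \<open>The finite q-Vandermonde sum\<close>

text \<open>With \<open>y\<close> independent of \<open>n\<close> and \<open>b\<close> arbitrary, the sum obeys a two-term recurrence in \<open>n\<close>: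
the splitting \<open>1 - q^(n+1) = (1 - q^(n+1-j)) + q^(n+1-j) (1 - q^j)\<close> (the q-Pascal rule) expresses the sum for
\<open>n + 1\<close> through those for \<open>n\<close> at \<open>b\<close> and at \<open>bq\<close>, and \<open>(1 - bq\<^sup>n) + q\<^sup>n (b - y) = 1 - yq\<^sup>n\<close>.\<close>

lemma q_vandermonde_homogeneous:
  fixes q b y :: complex
  assumes "qregular q q"
  shows "(\<Sum>j\<le>n. q ^ (j * (j - 1) div 2) * (\<Prod>l<j. b * q ^ l - y) * qpoch q (b * q ^ j) (n - j)
            / (qpoch q q j * qpoch q q (n - j))) = qpoch q y n / qpoch q q n"
proof (induction n arbitrary: b)
  case 0
  show ?case by simp
next
  case (Suc n)
  define T where "T b n j = q ^ (j * (j - 1) div 2) * (\<Prod>l<j. b * q ^ l - y) * qpoch q (b * q ^ j) (n - j)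
            / (qpoch q q j * qpoch q q (n - j))" for b n j
  have nz: "qpoch q q k \<noteq> 0" for k
    by (rule qpoch_nonzero[OF assms])
  have qk: "1 - q ^ Suc k \<noteq> 0" for k
    using qregularD[OF assms, of k] by simp
  have keep: "(1 - q ^ (Suc n - j)) * T b (Suc n) j = (1 - b * q ^ n) * T b n j" if "j \<le> n" for j
  proof -
    have *: "Suc n - j = Suc (n - j)" using that by simp
    have z: "b * q ^ j * q ^ (n - j) = b * q ^ n"
      using that by (simp add: mult.assoc flip: power_add)
    have cancel: "u * (t * (p * w) / (r * (s * u))) = w * (t * p / (r * s))" if "u \<noteq> 0"
      for u t p w r s :: complex
      using that by simp
    show ?thesis
      unfolding T_def * qpoch_Suc[of q "b * q ^ j"] qpoch_Suc[of q q "n - j"] z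
      using cancel[OF qk[of "n - j"]] by simp
  qed
  have raise: "q ^ (n - j) * (1 - q ^ Suc j) * T b (Suc n) (Suc j) = q ^ n * (b - y) * T (b * q) n j"
    if "j \<le> n" for j
  proof -
    have tri: "Suc j * j div 2 = j * (j - 1) div 2 + j"
      by (cases j) (simp_all add: algebra_simps)
    have pr: "(\<Prod>l<Suc j. b * q ^ l - y) = (b - y) * (\<Prod>l<j. b * q * q ^ l - y)"
      by (simp add: prod.lessThan_Suc_shift mult.assoc del: prod.lessThan_Suc)
    have qn: "q ^ n = q ^ (n - j) * q ^ j"
      using that by (simp flip: power_add)
    have cancel: "v * u * (t * p * (e * f) * g / ((r * u) * s)) = v * p * e * (t * f * g / (r * s))"
      if "u \<noteq> 0" for u v t p e f g r s :: complex
      using that by simp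
    show ?thesis
      unfolding T_def qpoch_Suc[of q q j] pr qn diff_Suc_1 tri power_add diff_Suc_Suc
      using cancel[OF qk[of j]] by (simp add: mult.assoc)
  qed
  have "(1 - q ^ Suc n) * (\<Sum>j\<le>Suc n. T b (Suc n) j)
      = (\<Sum>j\<le>Suc n. (1 - q ^ (Suc n - j)) * T b (Suc n) j)
        + (\<Sum>j\<le>Suc n. q ^ (Suc n - j) * (1 - q ^ j) * T b (Suc n) j)"
    unfolding sum_distrib_left sum.distrib[symmetric]
  proof (rule sum.cong[OF refl])
    fix j assume "j \<in> {..Suc n}"
    then have "q ^ Suc n = q ^ (Suc n - j) * q ^ j"
      by (simp del: power_Suc flip: power_add)
    then show "(1 - q ^ Suc n) * T b (Suc n) j
      = (1 - q ^ (Suc n - j)) * T b (Suc n) j + q ^ (Suc n - j) * (1 - q ^ j) * T b (Suc n) j"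
      by (simp only:) (simp add: algebra_simps)
  qed
  also have "(\<Sum>j\<le>Suc n. (1 - q ^ (Suc n - j)) * T b (Suc n) j) = (1 - b * q ^ n) * (\<Sum>j\<le>n. T b n j)"
    by (simp add: keep sum_distrib_left del: power_Suc)
  also have "(\<Sum>j\<le>Suc n. q ^ (Suc n - j) * (1 - q ^ j) * T b (Suc n) j)
      = (\<Sum>j\<le>n. q ^ (n - j) * (1 - q ^ Suc j) * T b (Suc n) (Suc j))"
    by (subst sum.atMost_Suc_shift) simp
  also have "\<dots> = q ^ n * (b - y) * (\<Sum>j\<le>n. T (b * q) n j)"
    by (simp add: raise sum_distrib_left del: power_Suc)
  also have "(\<Sum>j\<le>n. T b n j) = qpoch q y n / qpoch q q n"
    using Suc.IH[of b] by (simp add: T_def)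
  also have "(\<Sum>j\<le>n. T (b * q) n j) = qpoch q y n / qpoch q q n"
    using Suc.IH[of "b * q"] by (simp add: T_def)
  also have "(1 - b * q ^ n) * (qpoch q y n / qpoch q q n) + q ^ n * (b - y) * (qpoch q y n / qpoch q q n)
      = qpoch q y (Suc n) / qpoch q q n"
    by (simp add: qpoch_Suc algebra_simps add_divide_distrib diff_divide_distrib)
  finally have "(\<Sum>j\<le>Suc n. T b (Suc n) j) = qpoch q y (Suc n) / qpoch q q (Suc n)"
    using qk[of n] nz[of n] unfolding qpoch_Suc[of q q] power_Suc[symmetric] mult.commute[of q "q ^ n"]
    by (simp add: divide_simps ac_simps)
  then show ?case
    by (simp only: T_def)
qed

text \<open>The case \<open>y = abq\<^sup>n\<^sup>-\<^sup>1\<close>, in which \<open>bq\<^sup>l - y = bq\<^sup>l (1 - aq\<^sup>n\<^sup>-\<^sup>1\<^sup>-\<^sup>l)\<close>. The parameters \<open>a\<close> and \<open>b\<close> separate: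
\<open>a\<close> is attached to \<open>n - j\<close> and \<open>b\<close> to \<open>j\<close>.\<close>

lemma q_vandermonde:
  fixes q a b :: complex
  assumes q0: "q \<noteq> 0" and q1: "norm q < 1" and a: "qregular q a" and b: "qregular q b"
  shows "qpoch q (a * b * q powi (int n - 1)) n / (qpoch q q n * qpoch q a n * qpoch q b n)
    = (\<Sum>j\<le>n. b ^ j * q ^ (j * (j - 1)) / (qpoch q q j * qpoch q b j * (qpoch q q (n - j) * qpoch q a (n - j))))"
proof -
  define y where "y = a * b * q powi (int n - 1)"
  note qq = qregular_base[OF q1]
  note nz = qpoch_nonzero[OF qq] qpoch_nonzero[OF a] qpoch_nonzero[OF b]
  have pw: "q ^ (j * (j - 1) div 2) * (\<Prod>l<j. b * q ^ l - y)
      = b ^ j * q ^ (j * (j - 1)) * (qpoch q a n / qpoch q a (n - j))" if "j \<le> n" for j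
    using that
  proof (induction j)
    case 0
    then show ?case using nz by simp
  next
    case (Suc j)
    have e1: "n - j = Suc (n - Suc j)" using Suc.prems by simp
    have "y = b * q ^ j * (a * q ^ (n - Suc j))"
    proof -
      have "int n - 1 = int (j + (n - Suc j))" using Suc.prems by simp
      then show ?thesis
        unfolding y_def by (simp only: power_int_of_nat power_add) (simp only: ac_simps)
    qed
    then have y: "b * q ^ j - y = b * q ^ j * (1 - a * q ^ (n - Suc j))"
      by (simp add: algebra_simps)
    have tri: "Suc j * j div 2 = j * (j - 1) div 2 + j" "Suc j * j = j * (j - 1) + j + j"
      by (cases j; simp add: algebra_simps)+
    have "q ^ (Suc j * (Suc j - 1) div 2) * (\<Prod>l<Suc j. b * q ^ l - y)
       = (q ^ (j * (j - 1) div 2) * (\<Prod>l<j. b * q ^ l - y)) * q ^ j * (b * q ^ j - y)"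
      unfolding diff_Suc_1 tri(1) power_add prod.lessThan_Suc by (simp only: ac_simps)
    also have "\<dots> = (b ^ j * q ^ (j * (j - 1)) * (qpoch q a n / qpoch q a (n - j))) * q ^ j * (b * q ^ j * (1 - a * q ^ (n - Suc j)))"
      using Suc by (simp add: y)
    also have "\<dots> = b ^ Suc j * q ^ (Suc j * j) * ((qpoch q a n / qpoch q a (n - j)) * (1 - a * q ^ (n - Suc j)))"
      unfolding tri(2) power_add power_Suc by (simp only: ac_simps)
    also have "(qpoch q a n / qpoch q a (n - j)) * (1 - a * q ^ (n - Suc j)) = qpoch q a n / qpoch q a (n - Suc j)"
      unfolding e1 qpoch_Suc using nz(2)[of "n - Suc j"] qregularD[OF a, of "n - Suc j"] by simp
    finally show ?case by simp
  qed
  have "qpoch q y n / qpoch q q n / (qpoch q a n * qpoch q b n)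
    = (\<Sum>j\<le>n. b ^ j * q ^ (j * (j - 1)) / (qpoch q q j * qpoch q b j * (qpoch q q (n - j) * qpoch q a (n - j))))"
    unfolding q_vandermonde_homogeneous[OF qq, where n = n and b = b and y = y, symmetric] sum_divide_distrib
  proof (rule sum.cong[OF refl])
    fix j assume "j \<in> {..n}"
    then have j: "j \<le> n" by simp
    have "qpoch q b n = qpoch q b j * qpoch q (b * q ^ j) (n - j)"
      using qpoch_add[of q b j "n - j"] j by simp
    moreover have "qpoch q (b * q ^ j) (n - j) \<noteq> 0"
      by (intro qpoch_nonzero qregular_shift b)
    ultimately show "q ^ (j * (j - 1) div 2) * (\<Prod>l<j. b * q ^ l - y) * qpoch q (b * q ^ j) (n - j)
            / (qpoch q q j * qpoch q q (n - j)) / (qpoch q a n * qpoch q b n)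
        = b ^ j * q ^ (j * (j - 1)) / (qpoch q q j * qpoch q b j * (qpoch q q (n - j) * qpoch q a (n - j)))"
      unfolding pw[OF j] using nz by simp
  qed
  then show ?thesis
    by (simp add: y_def mult.assoc)
qed

section \<open>The two series and their recurrences\<close>

text \<open>The summand of the \<open>2\<phi>1\<close> series with numerator parameters \<open>C, D\<close>, denominator parameter \<open>a\<close> and argument
\<open>q\<close>, multiplied by \<open>(a;q)\<^sub>\<infinity>\<close>: writing \<open>(aq\<^sup>m;q)\<^sub>\<infinity>\<close> for \<open>(a;q)\<^sub>\<infinity> / (a;q)\<^sub>m\<close> removes the poles in \<open>a\<close>,
so that \<open>a\<close> can be replaced by \<open>a/q\<^sup>N\<close> without restriction.\<close>

definition phi_term :: "complex \<Rightarrow> complex \<Rightarrow> complex \<Rightarrow> complex \<Rightarrow> nat \<Rightarrow> complex" where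
  "phi_term q C D a m = qpoch q C m * qpoch q D m / qpoch q q m * q ^ m * qpoch_inf q (a * q ^ m)"

text \<open>Equal to \<open>C\<^sup>k (q/C;q)\<^sub>k\<close> for \<open>C \<noteq> 0\<close>, but a polynomial in \<open>C\<close>.\<close>

definition shifted_prod :: "complex \<Rightarrow> complex \<Rightarrow> nat \<Rightarrow> complex" where
  "shifted_prod q C k = (\<Prod>i<k. C - q ^ Suc i)"

text \<open>With \<open>x = 1/a\<close>, the summand of a very-well-poised \<open>8\<phi>7\<close> series with parameters \<open>q\<^sup>2x; q, q/C, q/D\<close> and
two further parameters sent to infinity, up to normalisation.\<close>

definition vwp_term :: "complex \<Rightarrow> complex \<Rightarrow> complex \<Rightarrow> complex \<Rightarrow> nat \<Rightarrow> complex" where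
  "vwp_term q C D x k =
     shifted_prod q C k * shifted_prod q D k * q ^ (k\<^sup>2 + 2 * k) * x ^ (2 * k) * (1 - x * q ^ (2 * k + 2))
       / (qpoch q (C * x * q) (Suc k) * qpoch q (D * x * q) (Suc k))"

context
  fixes q :: complex
  assumes q1: "norm q < 1"
begin

lemma phi_coeff_bounded:
  obtains K where "K > 0" "\<And>m. norm (qpoch q C m * qpoch q D m / qpoch q q m) \<le> K"
proof -
  obtain L where L: "L > 0" "\<And>n k. norm (inverse (qpoch q (q * q ^ n) k)) \<le> L"
    using inverse_qpoch_bounded[OF q1 qregular_base[OF q1]] by blast
  show thesis
  proof
    fix m
    have "norm (qpoch q C m * qpoch q D m * inverse (qpoch q q m))
        \<le> exp (norm C / (1 - norm q)) * exp (norm D / (1 - norm q)) * L"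
      unfolding norm_mult using L(2)[of 0 m] by (intro mult_mono norm_qpoch_le q1) auto
    then show "norm (qpoch q C m * qpoch q D m / qpoch q q m)
        \<le> exp (norm C / (1 - norm q)) * exp (norm D / (1 - norm q)) * L"
      by (simp add: divide_inverse)
  qed (use L in simp)
qed

lemma summable_norm_phi: "summable (\<lambda>m. norm (phi_term q C D a m))"
proof -
  obtain K where K: "K > 0" "\<And>m. norm (qpoch q C m * qpoch q D m / qpoch q q m) \<le> K"
    using phi_coeff_bounded[of C D] by blast
  show ?thesis
  proof (rule summable_comparison_test')
    show "summable (\<lambda>m. K * norm q ^ m * exp (norm a / (1 - norm q)))"
      using q1 by (intro summable_mult summable_mult2 summable_geometric) auto
    fix m
    have "norm (phi_term q C D a m) \<le> K * norm q ^ m * exp (norm a / (1 - norm q))"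
      unfolding phi_term_def norm_mult[of _ "qpoch_inf q _"] norm_mult[of _ "q ^ _"] norm_power
      using K by (intro mult_mono norm_qpoch_inf_le_mono norm_shift_le q1) auto
    then show "norm (norm (phi_term q C D a m)) \<le> K * norm q ^ m * exp (norm a / (1 - norm q))"
      by simp
  qed
qed

text \<open>The combination of the summands at \<open>a\<close> and \<open>a/q\<close> is a forward difference of
\<open>G\<^sub>m = aq (C, D;q)\<^sub>m (1 - q\<^sup>m) / (q;q)\<^sub>m * (aq\<^sup>m\<^sup>-\<^sup>1;q)\<^sub>\<infinity>\<close>. As the series does not terminate, the limit of \<open>G\<^sub>m\<close>
remains as an inhomogeneity.\<close>

lemma phi_recurrence:
  assumes q0: "q \<noteq> 0"
  shows "(a - C * q) * (a - D * q) * (\<Sum>m. phi_term q C D a m)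
     + q * (a - C * D * q) * (\<Sum>m. phi_term q C D (a / q) m)
   = a * q * (qpoch_inf q C * qpoch_inf q D / qpoch_inf q q)"
proof -
  note qq = qregular_base[OF q1]
  define G where "G m = a * q * (qpoch q C m * qpoch q D m / qpoch q q m) * (1 - q ^ m)
    * qpoch_inf q (a / q * q ^ m)" for m
  have "G \<longlonglongrightarrow> a * q * (qpoch_inf q C * qpoch_inf q D / qpoch_inf q q) * (1 - 0) * 1"
    unfolding G_def using q1
    by (intro tendsto_intros qpoch_tendsto_qpoch_inf qpoch_inf_nonzero LIMSEQ_power_zero
          qpoch_inf_shift_tendsto_1 qq) auto
  then have "(\<lambda>m. G (Suc m) - G m) sums (a * q * (qpoch_inf q C * qpoch_inf q D / qpoch_inf q q) - G 0)"
    by (intro telescope_sums) simp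
  moreover have "G (Suc m) - G m = (a - C * q) * (a - D * q) * phi_term q C D a m
      + q * (a - C * D * q) * phi_term q C D (a / q) m" for m
  proof -
    define P y I where "P = qpoch q C m * qpoch q D m / qpoch q q m"
      and "y = q ^ m" and "I = qpoch_inf q (a * q ^ m)"
    define z where "z = a / q"
    have az: "a = z * q" using q0 by (simp add: z_def)
    have I': "qpoch_inf q (z * q ^ m) = (1 - z * y) * I"
      using qpoch_inf_split[OF q1, of "z * q ^ m" 1] 
      by (simp add: qpoch_Suc I_def y_def az mult_ac)
    have I'': "qpoch_inf q (z * q ^ Suc m) = I"
      by (simp add: I_def az mult_ac)
    have P': "qpoch q C (Suc m) * qpoch q D (Suc m) / qpoch q q (Suc m) * (1 - q ^ Suc m)
        = P * (1 - C * y) * (1 - D * y)"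
      using qpoch_nonzero[OF qq, of m] qregularD[OF qq, of m] by (simp add: qpoch_Suc P_def y_def)
    have "G (Suc m) = a * q * (P * (1 - C * y) * (1 - D * y)) * I"
      unfolding G_def z_def[symmetric] I'' P'[symmetric] by (simp only: mult.assoc)
    moreover have "G m = a * q * P * (1 - y) * ((1 - z * y) * I)"
      unfolding G_def z_def[symmetric] I' P_def y_def by (simp only: mult.assoc)
    moreover have "phi_term q C D a m = P * y * I"
      by (simp add: phi_term_def P_def y_def I_def)
    moreover have "phi_term q C D (a / q) m = P * y * ((1 - z * y) * I)"
      unfolding phi_term_def P_def y_def z_def[symmetric] I' ..
    ultimately show ?thesis
      unfolding az by (simp only:) (simp add: algebra_simps)
  qed
  moreover have "G 0 = 0"
    by (simp add: G_def)
  ultimately have "(\<lambda>m. (a - C * q) * (a - D * q) * phi_term q C D a m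
      + q * (a - C * D * q) * phi_term q C D (a / q) m) sums (a * q * (qpoch_inf q C * qpoch_inf q D / qpoch_inf q q))"
    by simp
  moreover have "(\<lambda>m. (a - C * q) * (a - D * q) * phi_term q C D a m
      + q * (a - C * D * q) * phi_term q C D (a / q) m) sums
      ((a - C * q) * (a - D * q) * (\<Sum>m. phi_term q C D a m)
     + q * (a - C * D * q) * (\<Sum>m. phi_term q C D (a / q) m))"
    by (intro sums_add sums_mult summable_sums summable_norm_cancel[OF summable_norm_phi])
  ultimately show ?thesis
    by (rule sums_unique2[rotated])
qed

lemma norm_shifted_prod_le:
  assumes "norm C \<le> R"
  shows "norm (shifted_prod q C k) \<le> (R + 1) ^ k"
proof -
  have "norm (C - q ^ Suc i) \<le> R + 1" for i
    using norm_triangle_ineq4[of C "q ^ Suc i"] assms norm_power_q_le_1[OF q1, of "Suc i"] by linarith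
  then have "norm (shifted_prod q C k) \<le> (\<Prod>i<k. R + 1)"
    unfolding shifted_prod_def prod_norm[symmetric] by (intro prod_mono) auto
  then show ?thesis by simp
qed

lemma norm_vwp_numerator_le:
  assumes "norm C \<le> R" "norm D \<le> R" "norm x \<le> R"
  shows "norm (shifted_prod q C k * shifted_prod q D k * q ^ (k\<^sup>2 + 2 * k) * x ^ (2 * k))
    \<le> ((R + 1)\<^sup>2 * R\<^sup>2) ^ k * norm q ^ k\<^sup>2"
proof -
  have R: "R \<ge> 0" using assms(1) norm_ge_zero order_trans by blast
  have "norm (q ^ (k\<^sup>2 + 2 * k)) \<le> norm q ^ k\<^sup>2"
    using q1 by (simp add: norm_power power_decreasing)
  then have "norm (shifted_prod q C k * shifted_prod q D k * q ^ (k\<^sup>2 + 2 * k) * x ^ (2 * k))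
    \<le> (R + 1) ^ k * (R + 1) ^ k * norm q ^ k\<^sup>2 * R ^ (2 * k)"
    unfolding norm_mult using R assms
    by (intro mult_mono norm_shifted_prod_le) (auto simp: norm_power intro!: power_mono)
  also have "\<dots> = ((R + 1)\<^sup>2 * R\<^sup>2) ^ k * norm q ^ k\<^sup>2"
    by (simp add: power_mult_distrib power2_eq_square power_mult)
  finally show ?thesis .
qed

text \<open>The factor \<open>q^(k^2)\<close> dominates everything else. The bound is uniform over all parameters in a disc whose
denominators lie on two fixed q-orbits; this covers the shift of \<open>x\<close> to \<open>xq\<^sup>N\<close> with \<open>C, D\<close> fixed, used in the
iteration, as well as that of \<open>C, D\<close> to \<open>Cq\<^sup>n, Dq\<^sup>n\<close> with \<open>x\<close> fixed, used for the inner sums.\<close>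

lemma vwp_sum_bounded:
  assumes "qregular q y" "qregular q z"
  obtains B where "\<And>C D x m n. norm C \<le> R \<Longrightarrow> norm D \<le> R \<Longrightarrow> norm x \<le> R \<Longrightarrow>
      C * x * q = y * q ^ m \<Longrightarrow> D * x * q = z * q ^ n \<Longrightarrow>
      summable (vwp_term q C D x) \<and> norm (\<Sum>k. vwp_term q C D x k) \<le> B"
proof -
  obtain K where K: "K > 0" "\<And>n k. norm (inverse (qpoch q (y * q ^ n) k)) \<le> K"
    using inverse_qpoch_bounded[OF q1 assms(1)] by blast
  obtain L where L: "L > 0" "\<And>n k. norm (inverse (qpoch q (z * q ^ n) k)) \<le> L"
    using inverse_qpoch_bounded[OF q1 assms(2)] by blast
  define M where "M k = ((R + 1)\<^sup>2 * R\<^sup>2) ^ k * norm q ^ k\<^sup>2 * (1 + R) * (K * L)" for k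
  have M: "summable M"
    unfolding M_def by (intro summable_mult2 summable_power_mult_gauss q1) simp
  show thesis
  proof
    fix C D x :: complex and m n :: nat
    assume *: "norm C \<le> R" "norm D \<le> R" "norm x \<le> R"
      "C * x * q = y * q ^ m" "D * x * q = z * q ^ n"
    have bd: "norm (vwp_term q C D x k) \<le> M k" for k
    proof -
      have "norm (1 - x * q ^ (2 * k + 2)) \<le> 1 + R"
        using norm_triangle_ineq4[of 1 "x * q ^ (2 * k + 2)"] norm_shift_le[OF q1, of x "2 * k + 2"] *(3)
        by simp
      moreover have "vwp_term q C D x k = shifted_prod q C k * shifted_prod q D k * q ^ (k\<^sup>2 + 2 * k) * x ^ (2 * k)
         * (1 - x * q ^ (2 * k + 2)) * (inverse (qpoch q (y * q ^ m) (Suc k)) * inverse (qpoch q (z * q ^ n) (Suc k)))"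
        unfolding vwp_term_def *(4,5) divide_inverse by simp
      moreover have "norm (num * u * (v * w)) \<le> A * E * (K * L)"
        if "norm num \<le> A" "norm u \<le> E" "norm v \<le> K" "norm w \<le> L" for num u v w :: complex and A E
      proof -
        have "0 \<le> A" "0 \<le> E"
          using that(1,2) norm_ge_zero order_trans by blast+
        then show ?thesis
          unfolding norm_mult using that K(1) by (intro mult_mono) auto
      qed
      ultimately show ?thesis
        unfolding M_def using norm_vwp_numerator_le[OF *(1-3), of k] K(2) L(2) by simp
    qed
    have s: "summable (\<lambda>k. norm (vwp_term q C D x k))"
      by (rule summable_comparison_test'[OF M, of 0]) (use bd in simp)
    have "norm (\<Sum>k. vwp_term q C D x k) \<le> suminf M"
      using summable_norm[OF s] suminf_le[OF bd s M] by linarith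
    with s show "summable (vwp_term q C D x) \<and> norm (\<Sum>k. vwp_term q C D x k) \<le> suminf M"
      by (blast intro: summable_norm_cancel)
  qed
qed

lemma summable_vwp:
  assumes "qregular q (C * x * q)" "qregular q (D * x * q)"
  shows "summable (vwp_term q C D x)"
proof -
  define R where "R = norm C + norm D + norm x"
  have R: "norm C \<le> R" "norm D \<le> R" "norm x \<le> R"
    by (simp_all add: R_def)
  show ?thesis
  proof (rule vwp_sum_bounded[OF assms, of R])
    fix B
    assume *: "\<And>C' D' x' m n. norm C' \<le> R \<Longrightarrow> norm D' \<le> R \<Longrightarrow> norm x' \<le> R \<Longrightarrow>
      C' * x' * q = C * x * q * q ^ m \<Longrightarrow> D' * x' * q = D * x * q * q ^ n \<Longrightarrow>
      summable (vwp_term q C' D' x') \<and> norm (\<Sum>k. vwp_term q C' D' x' k) \<le> B"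
    show ?thesis
      using *[OF R, of 0 0] by simp
  qed
qed

text \<open>Telescoping again: the combination of the summands is \<open>V\<^sub>k - V\<^sub>k\<^sub>+\<^sub>1\<close> with
\<open>V\<^sub>k = (C - q)\<dots>(C - q\<^sup>k) (D - q)\<dots>(D - q\<^sup>k) q^(k^2+2k) x^(2k) / (Cxq\<^sup>2, Dxq\<^sup>2;q)\<^sub>k\<close>, where \<open>V\<^sub>0 = 1\<close> and \<open>V\<^sub>k\<close> tends to \<open>0\<close>.\<close>

lemma vwp_recurrence:
  assumes C: "qregular q (C * x * q)" and D: "qregular q (D * x * q)"
  shows "(1 - C * q * x) * (1 - D * q * x) * (\<Sum>k. vwp_term q C D x k)
    + q\<^sup>2 * x * (1 - C * D * q * x) * (\<Sum>k. vwp_term q C D (x * q) k) = 1"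
proof -
  define P where "P k = shifted_prod q C k * shifted_prod q D k * q ^ (k\<^sup>2 + 2 * k) * x ^ (2 * k)" for k
  define U where "U k = qpoch q (C * x * q * q) k * qpoch q (D * x * q * q) k" for k
  define V where "V k = P k / U k" for k
  have C': "qregular q (C * x * q * q)" and D': "qregular q (D * x * q * q)"
    using qregular_shift[OF C, of 1] qregular_shift[OF D, of 1] by simp_all
  have U: "U k \<noteq> 0" for k
    by (simp add: U_def qpoch_nonzero C' D')
  have "P \<longlonglongrightarrow> 0"
  proof -
    define R where "R = norm C + norm D + norm x"
    have "norm C \<le> R" "norm D \<le> R" "norm x \<le> R"
      by (simp_all add: R_def)
    then have "norm (P k) \<le> ((R + 1)\<^sup>2 * R\<^sup>2) ^ k * norm q ^ k\<^sup>2" for k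
      unfolding P_def by (rule norm_vwp_numerator_le)
    moreover have "(\<lambda>k. ((R + 1)\<^sup>2 * R\<^sup>2) ^ k * norm q ^ k\<^sup>2) \<longlonglongrightarrow> 0"
      by (intro summable_LIMSEQ_zero summable_power_mult_gauss q1) simp
    ultimately show ?thesis
      by (rule Lim_null_comparison[OF always_eventually[OF allI]])
  qed
  moreover have "U \<longlonglongrightarrow> qpoch_inf q (C * x * q * q) * qpoch_inf q (D * x * q * q)"
    unfolding U_def by (intro tendsto_intros qpoch_tendsto_qpoch_inf q1)
  ultimately have "V \<longlonglongrightarrow> 0 / (qpoch_inf q (C * x * q * q) * qpoch_inf q (D * x * q * q))"
    unfolding V_def by (rule tendsto_divide) (simp add: qpoch_inf_nonzero q1 C' D')
  then have "(\<lambda>k. V k - V (Suc k)) sums (V 0 - 0)"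
    by (intro telescope_sums') simp
  moreover have "V k - V (Suc k) = (1 - C * q * x) * (1 - D * q * x) * vwp_term q C D x k
      + q\<^sup>2 * x * (1 - C * D * q * x) * vwp_term q C D (x * q) k" for k
  proof -
    define y where "y = q ^ k"
    define e f where "e = 1 - C * x * q * q * y" and "f = 1 - D * x * q * q * y"
    have ef: "e \<noteq> 0" "f \<noteq> 0"
      using qregularD[OF C', of k] qregularD[OF D', of k] by (simp_all add: e_def f_def y_def)
    have nz: "1 - C * q * x \<noteq> 0" "1 - D * q * x \<noteq> 0"
      using qregularD[OF C, of 0] qregularD[OF D, of 0] by (simp_all add: mult_ac)
    have U': "U (Suc k) = U k * e * f"
      by (simp add: U_def qpoch_Suc e_def f_def y_def)
    have P': "P (Suc k) = P k * (C - q * y) * (D - q * y) * q ^ 3 * y\<^sup>2 * x\<^sup>2"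
    proof -
      have "(Suc k)\<^sup>2 + 2 * Suc k = (k\<^sup>2 + 2 * k) + 3 + k * 2" "2 * Suc k = 2 * k + 2"
        by (simp_all add: power2_eq_square)
      then show ?thesis
        unfolding P_def y_def power_mult[symmetric] shifted_prod_def prod.lessThan_Suc
        by (simp only: power_add power_Suc) (simp only: ac_simps)
    qed
    have q2k: "q ^ (2 * k + 2) = q\<^sup>2 * y\<^sup>2"
      unfolding power_add power_even_eq y_def by (rule mult.commute)
    have S: "qpoch q (C * x * q) (Suc k) * qpoch q (D * x * q) (Suc k) = (1 - C * q * x) * (1 - D * q * x) * U k"
      unfolding qpoch_Suc_left U_def by (simp only: ac_simps)
    have S': "qpoch q (C * (x * q) * q) (Suc k) * qpoch q (D * (x * q) * q) (Suc k) = U (Suc k)"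
      by (simp only: U_def ac_simps)
    have A: "(1 - C * q * x) * (1 - D * q * x) * vwp_term q C D x k = P k * (1 - x * (q\<^sup>2 * y\<^sup>2)) / U k"
      unfolding vwp_term_def S P_def q2k using nz by simp
    have "(x * q) ^ (2 * k) = x ^ (2 * k) * y\<^sup>2"
      by (simp only: power_mult_distrib y_def power_even_eq[of q])
    then have B: "vwp_term q C D (x * q) k = P k * y\<^sup>2 * (1 - x * q * (q\<^sup>2 * y\<^sup>2)) / (U k * e * f)"
      unfolding vwp_term_def S' U' P_def q2k by (simp only: ac_simps)
    \<comment> \<open>With common denominators, the telescoping relation is this polynomial identity in \<open>y = q\<^sup>k\<close>.\<close>
    have poly: "e * f - (C - q * y) * (D - q * y) * q ^ 3 * y\<^sup>2 * x\<^sup>2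
        = (1 - x * (q\<^sup>2 * y\<^sup>2)) * e * f + q\<^sup>2 * x * (1 - C * D * q * x) * y\<^sup>2 * (1 - x * q * (q\<^sup>2 * y\<^sup>2))"
      unfolding e_def f_def by algebra
    have "V k - V (Suc k) = P k * (e * f - (C - q * y) * (D - q * y) * q ^ 3 * y\<^sup>2 * x\<^sup>2) / (U k * e * f)"
      unfolding V_def U' P' using ef U[of k] by (simp add: field_simps)
    also have "\<dots> = P k * (1 - x * (q\<^sup>2 * y\<^sup>2)) / U k
        + q\<^sup>2 * x * (1 - C * D * q * x) * (P k * y\<^sup>2 * (1 - x * q * (q\<^sup>2 * y\<^sup>2)) / (U k * e * f))"
      unfolding poly distrib_left add_divide_distrib using ef U[of k] by simp
    finally show ?thesis
      unfolding A B .
  qed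
  moreover have "V 0 = 1"
    by (simp add: V_def P_def U_def shifted_prod_def)
  ultimately have "(\<lambda>k. (1 - C * q * x) * (1 - D * q * x) * vwp_term q C D x k
      + q\<^sup>2 * x * (1 - C * D * q * x) * vwp_term q C D (x * q) k) sums 1"
    by simp
  moreover have "(\<lambda>k. (1 - C * q * x) * (1 - D * q * x) * vwp_term q C D x k
      + q\<^sup>2 * x * (1 - C * D * q * x) * vwp_term q C D (x * q) k) sums
      ((1 - C * q * x) * (1 - D * q * x) * (\<Sum>k. vwp_term q C D x k)
    + q\<^sup>2 * x * (1 - C * D * q * x) * (\<Sum>k. vwp_term q C D (x * q) k))"
    using C D C' D'
    by (intro sums_add sums_mult summable_sums summable_vwp) (simp_all add: mult_ac)
  ultimately show ?thesis
    by (rule sums_unique2[rotated])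
qed

section \<open>Iteration of the recurrence\<close>

text \<open>The factors \<open>-q^(i+1)/a\<close> are those picked up by iterating the homogeneous recurrence. They exceed \<open>1\<close> in
modulus only finitely often, so their products over arbitrary finite index sets are uniformly bounded.\<close>

lemma theta_prod_bounded:
  assumes "finite A"
  shows "norm (\<Prod>i\<in>A. - (q ^ Suc i / a)) \<le> exp (1 / (norm a * (1 - norm q)))"
proof -
  have "norm (\<Prod>i\<in>A. - (q ^ Suc i / a)) \<le> (\<Prod>i\<in>A. 1 + norm q ^ i / norm a)"
    unfolding prod_norm[symmetric]
  proof (intro prod_mono conjI norm_ge_zero)
    fix i
    have "norm q ^ Suc i / norm a \<le> norm q ^ i / norm a"
      using q1 by (intro divide_right_mono power_decreasing) auto
    then show "norm (- (q ^ Suc i / a)) \<le> 1 + norm q ^ i / norm a"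
      by (simp add: norm_divide norm_power norm_mult)
  qed
  also have "\<dots> \<le> exp (\<Sum>i\<in>A. norm q ^ i / norm a)"
    by (rule prod_le_exp_sum) simp
  also have "(\<Sum>i\<in>A. norm q ^ i / norm a) \<le> (\<Sum>i. norm q ^ i / norm a)"
    using q1 assms by (intro sum_le_suminf summable_divide summable_geometric) auto
  also have "\<dots> = 1 / (norm a * (1 - norm q))"
    using q1 by (simp add: suminf_divide summable_geometric suminf_geometric)
  finally show ?thesis by simp
qed

text \<open>The growth of \<open>(a/q\<^sup>n;q)\<^sub>n\<close> as \<open>n\<close> increases is exactly compensated by these factors, since
\<open>-(q\<^sup>i/a) (1 - a/q\<^sup>i) = 1 - q\<^sup>i/a\<close>.\<close>

lemma qpoch_shift_down:
  assumes q0: "q \<noteq> 0" and "a \<noteq> 0"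
  shows "(\<Prod>i<n. - (q ^ Suc i / a)) * qpoch q (a / q ^ n) n = qpoch q (q / a) n"
proof (induction n)
  case (Suc n)
  have "qpoch q (a / q ^ Suc n) (Suc n) = (1 - a / q ^ Suc n) * qpoch q (a / q ^ n) n"
    unfolding qpoch_Suc_left using q0 by simp
  moreover have "- (q ^ Suc n / a) * (1 - a / q ^ Suc n) = 1 - q / a * q ^ n"
    using assms by (simp add: field_simps)
  moreover have "(\<Prod>i<Suc n. - (q ^ Suc i / a)) * (v * w) = (- (q ^ Suc n / a) * v) * ((\<Prod>i<n. - (q ^ Suc i / a)) * w)" for v w
    by (simp only: prod.lessThan_Suc ac_simps)
  ultimately show ?case
    by (simp only: Suc.IH qpoch_Suc) (simp only: ac_simps)
qed simp

lemma theta_prod_tendsto_0: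
  assumes "m > 0"
  shows "(\<lambda>N. \<Prod>i\<in>{N - m..<N}. - (q ^ Suc i / a)) \<longlonglongrightarrow> 0"
proof (rule Lim_null_comparison)
  define B where "B = exp (1 / (norm a * (1 - norm q)))"
  show "eventually (\<lambda>N. norm (\<Prod>i\<in>{N - m..<N}. - (q ^ Suc i / a)) \<le> B * norm (q ^ N / a)) sequentially"
    using eventually_gt_at_top[of 0]
  proof eventually_elim
    case (elim N)
    have "{N - m..<N} = insert (N - 1) {N - m..<N - 1}"
      using elim assms by auto
    then have "(\<Prod>i\<in>{N - m..<N}. - (q ^ Suc i / a)) = - (q ^ N / a) * (\<Prod>i\<in>{N - m..<N - 1}. - (q ^ Suc i / a))"
      using elim by (simp del: power_Suc)
    also have "norm \<dots> \<le> norm (q ^ N / a) * B"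
      unfolding norm_mult norm_minus_cancel B_def by (intro mult_left_mono theta_prod_bounded) auto
    finally show ?case by (simp only: mult.commute)
  qed
  have "(\<lambda>N. B * norm (q ^ N * inverse a)) \<longlonglongrightarrow> B * norm (0 * inverse a)"
    using q1 by (intro tendsto_intros LIMSEQ_power_zero) auto
  then show "(\<lambda>N. B * norm (q ^ N / a)) \<longlonglongrightarrow> 0"
    by (simp add: divide_inverse)
qed

text \<open>By \<open>qpoch_shift_down\<close>, for \<open>m \<le> N\<close> the normalised \<open>m\<close>-th summand at \<open>a/q\<^sup>N\<close> carries the factor
\<open>(q/a;q)\<^sub>N\<^sub>-\<^sub>m (a;q)\<^sub>\<infinity>\<close> times a product of \<open>m\<close> of the factors \<open>-q^(i+1)/a\<close> with \<open>i\<close> just below \<open>N\<close>. That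
product tends to \<open>0\<close> unless \<open>m = 0\<close>, and everything is dominated by a multiple of \<open>|q|\<^sup>m\<close>. In this form
nothing is divided by \<open>(a/q\<^sup>N;q)\<^sub>N\<close>, which vanishes for large \<open>N\<close> when \<open>a\<close> is a positive power of \<open>q\<close>.\<close>

lemma phi_limit:
  assumes q0: "q \<noteq> 0" and a: "a \<noteq> 0"
  shows "(\<lambda>N. (\<Prod>i<N. - (q ^ Suc i / a)) * (\<Sum>m. phi_term q C D (a / q ^ N) m))
    \<longlonglongrightarrow> qpoch_inf q a * qpoch_inf q (q / a)"
proof -
  define w where "w A = (\<Prod>i\<in>A. - (q ^ Suc i / a))" for A
  define B where "B = exp (1 / (norm a * (1 - norm q)))"
  have wB: "norm (w A) \<le> B" if "finite A" for A
    unfolding w_def B_def by (rule theta_prod_bounded[OF that])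
  define c where "c m = qpoch q C m * qpoch q D m / qpoch q q m" for m
  obtain K where K: "K > 0" "\<And>m. norm (c m) \<le> K"
    using phi_coeff_bounded[of C D] unfolding c_def by metis
  define E E' where "E = exp (norm a / (1 - norm q))" and "E' = exp (norm (q / a) / (1 - norm q))"
  define t where "t m N = w {..<N} * qpoch_inf q (a / q ^ N * q ^ m)" for m N
  have t_le: "t m N = w {N - m..<N} * qpoch q (q / a) (N - m) * qpoch_inf q a" if "m \<le> N" for m N
  proof -
    have "{..<N} = {..<N - m} \<union> {N - m..<N}" "{..<N - m} \<inter> {N - m..<N} = {}"
      by auto
    then have w: "w {..<N} = w {N - m..<N} * w {..<N - m}"
      unfolding w_def by (simp add: prod.union_disjoint)
    have x: "a / q ^ N * q ^ m = a / q ^ (N - m)"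
      using that q0 by (simp add: power_diff)
    have "qpoch_inf q (a / q ^ (N - m)) = qpoch q (a / q ^ (N - m)) (N - m) * qpoch_inf q a"
      using qpoch_inf_split[OF q1, of "a / q ^ (N - m)" "N - m"] q0 by simp
    then show ?thesis
      unfolding t_def w x using qpoch_shift_down[OF q0 a, of "N - m"]
      by (simp add: w_def mult.assoc)
  qed
  have t_bound: "norm (t m N) \<le> B * E' * E" for m N
  proof (cases "m \<le> N")
    case True
    then show ?thesis
      unfolding t_le[OF True] norm_mult E_def E'_def
      by (intro mult_mono wB norm_qpoch_le norm_qpoch_inf_le q1) (auto simp: B_def)
  next
    case False
    then have x: "a / q ^ N * q ^ m = a * q ^ (m - N)"
      using q0 by (simp add: power_diff)
    have "norm (t m N) \<le> B * E"
      unfolding t_def x norm_mult E_def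
      by (intro mult_mono wB norm_qpoch_inf_le_mono norm_shift_le q1) (auto simp: B_def)
    also have "\<dots> \<le> (B * E) * E'"
      using mult_left_mono[of 1 E' "B * E"] q1 by (simp add: E'_def B_def E_def)
    finally show ?thesis by (simp add: mult_ac)
  qed
  have t_lim: "t m \<longlonglongrightarrow> (if m = 0 then qpoch_inf q a * qpoch_inf q (q / a) else 0)" for m
  proof -
    have "(\<lambda>N. qpoch q (q / a) (N - m)) \<longlonglongrightarrow> qpoch_inf q (q / a)"
      by (rule LIMSEQ_offset[of _ m]) (simp add: qpoch_tendsto_qpoch_inf q1)
    moreover have "(\<lambda>N. w {N - m..<N}) \<longlonglongrightarrow> (if m = 0 then 1 else 0)"
      unfolding w_def using theta_prod_tendsto_0[of m a] by (cases "m = 0") auto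
    ultimately have "(\<lambda>N. w {N - m..<N} * qpoch q (q / a) (N - m) * qpoch_inf q a)
        \<longlonglongrightarrow> (if m = 0 then 1 else 0) * qpoch_inf q (q / a) * qpoch_inf q a"
      by (intro tendsto_intros)
    moreover have "eventually (\<lambda>N. w {N - m..<N} * qpoch q (q / a) (N - m) * qpoch_inf q a = t m N) sequentially"
      using eventually_ge_at_top[of m] by eventually_elim (simp add: t_le)
    ultimately have "t m \<longlonglongrightarrow> (if m = 0 then 1 else 0) * qpoch_inf q (q / a) * qpoch_inf q a"
      by (rule Lim_transform_eventually)
    then show ?thesis
      by (cases "m = 0") (simp_all add: mult.commute)
  qed
  define l where "l m = c m * q ^ m * (if m = 0 then qpoch_inf q a * qpoch_inf q (q / a) else 0)" for m
  have scaled: "w {..<N} * phi_term q C D (a / q ^ N) m = c m * q ^ m * t m N" for m N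
    unfolding phi_term_def t_def c_def by (simp only: ac_simps)
  have "(\<lambda>N. \<Sum>m. c m * q ^ m * t m N) \<longlonglongrightarrow> suminf l"
  proof (rule tannerys_theorem[THEN conjunct2, THEN conjunct2])
    show "(\<lambda>N. c m * q ^ m * t m N) \<longlonglongrightarrow> l m" for m
      unfolding l_def by (intro tendsto_mult tendsto_const t_lim)
    show "summable (\<lambda>m. K * norm q ^ m * (B * E' * E))"
      using q1 by (intro summable_mult summable_mult2 summable_geometric) auto
    have "norm (c m * q ^ m * t m N) \<le> K * norm q ^ m * (B * E' * E)" for m N
      unfolding norm_mult[of _ "t m N"] norm_mult[of _ "q ^ m"] norm_power
      using K by (intro mult_mono t_bound) auto
    then show "eventually (\<lambda>(m, N). norm (c m * q ^ m * t m N) \<le> K * norm q ^ m * (B * E' * E))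
        (at_top \<times>\<^sub>F sequentially)"
      by (intro always_eventually) auto
  qed simp
  moreover have "suminf l = qpoch_inf q a * qpoch_inf q (q / a)"
    by (subst suminf_finite[of "{0}"]) (auto simp: l_def c_def)
  moreover have "(\<Sum>m. c m * q ^ m * t m N) = w {..<N} * (\<Sum>m. phi_term q C D (a / q ^ N) m)" for N
    unfolding scaled[symmetric]
    by (intro suminf_mult summable_norm_cancel[OF summable_norm_phi])
  ultimately show ?thesis
    by (simp add: w_def)
qed

text \<open>The nonterminating q-Vandermonde sum, with its second series transformed into a very-well-poised one so
that positive powers of \<open>q\<close> are admitted as values of \<open>a\<close>.\<close>

theorem nonterminating_q_vandermonde:
  assumes q0: "q \<noteq> 0" and a: "a \<noteq> 0" and C: "qregular q (C * q / a)" and D: "qregular q (D * q / a)"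
  shows "(\<Sum>m. phi_term q C D a m)
    = qpoch_inf q a * qpoch_inf q (q / a) * qpoch_inf q (C * D * q / a)
        / (qpoch_inf q (C * q / a) * qpoch_inf q (D * q / a))
      + q / a * (qpoch_inf q C * qpoch_inf q D / qpoch_inf q q) * (\<Sum>k. vwp_term q C D (1 / a) k)"
proof -
  define L where "L = qpoch_inf q C * qpoch_inf q D / qpoch_inf q q"
  define \<Phi> S F where "\<Phi> b = (\<Sum>m. phi_term q C D b m)"
    and "S x = (\<Sum>k. vwp_term q C D x k)"
    and "F b = (\<Sum>m. phi_term q C D b m) - q / b * L * (\<Sum>k. vwp_term q C D (1 / b) k)" for b x
  define b where "b N = a / q ^ N" for N
  define W where "W N = (\<Prod>i<N. - (q ^ Suc i / a))" for N
  define Q where "Q N = qpoch q (C * D * q / a) N / (qpoch q (C * q / a) N * qpoch q (D * q / a) N)" for N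
  have b0: "b N \<noteq> 0" for N
    using a q0 by (simp add: b_def)
  have Cb: "C * q / b N = C * q / a * q ^ N" and Db: "D * q / b N = D * q / a * q ^ N"
    and CDb: "C * D * q / b N = C * D * q / a * q ^ N" for N
    by (simp_all add: b_def)
  \<comment> \<open>The recurrences for \<open>\<Phi>\<close> at \<open>b N\<close> and for \<open>S\<close> at \<open>1 / b N\<close> have proportional right-hand sides, which cancel in \<open>F\<close>.\<close>
  have step: "F (b N) = - (q ^ Suc N / a) * ((1 - C * D * q / a * q ^ N)
      / ((1 - C * q / a * q ^ N) * (1 - D * q / a * q ^ N))) * F (b (Suc N))" for N
  proof -
    define e where "e = b N"
    have e0: "e \<noteq> 0" using b0 by (simp add: e_def)
    have bS: "b (Suc N) = e / q"
      by (simp add: b_def e_def mult.commute)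
    have nz: "1 - C * q / e \<noteq> 0" "1 - D * q / e \<noteq> 0"
      using qregularD[OF C, of N] qregularD[OF D, of N] by (simp_all only: e_def Cb Db) auto
    have reg: "qregular q (C * (1 / e) * q)" "qregular q (D * (1 / e) * q)"
      using qregular_shift[OF C, of N] qregular_shift[OF D, of N] Cb[of N] Db[of N] by (simp_all add: e_def)
    have 1: "(e - C * q) * (e - D * q) * \<Phi> e + q * (e - C * D * q) * \<Phi> (e / q) = e * q * L"
      unfolding \<Phi>_def L_def by (rule phi_recurrence[OF q0])
    have 2: "(1 - C * q / e) * (1 - D * q / e) * S (1 / e) + q\<^sup>2 / e * (1 - C * D * q / e) * S (q / e) = 1"
      unfolding S_def using vwp_recurrence[OF reg] by simp
    have sc: "e - C * q = e * (1 - C * q / e)" "e - D * q = e * (1 - D * q / e)" "e - C * D * q = e * (1 - C * D * q / e)"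
      using e0 by (simp_all add: field_simps)
    have 3: "e * (1 - C * q / e) * (1 - D * q / e) * \<Phi> e + q * (1 - C * D * q / e) * \<Phi> (e / q) = q * L"
    proof -
      have "e * (e * u * v * X + q * w * Y) = e * u * (e * v) * X + q * (e * w) * Y" for u v w X Y
        by (simp add: algebra_simps)
      from this[of "1 - C * q / e" "1 - D * q / e" "\<Phi> e" "1 - C * D * q / e" "\<Phi> (e / q)"]
      have "e * (e * (1 - C * q / e) * (1 - D * q / e) * \<Phi> e + q * (1 - C * D * q / e) * \<Phi> (e / q)) = e * (q * L)"
        using 1 unfolding sc by (simp only: mult.assoc)
      then show ?thesis
        using e0 by (simp only: mult_cancel_left) simp
    qed
    have F: "e * F e = e * \<Phi> e - q * L * S (1 / e)" "F (e / q) = \<Phi> (e / q) - q\<^sup>2 / e * L * S (q / e)"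
      using e0 q0 by (simp_all add: F_def \<Phi>_def S_def right_diff_distrib power2_eq_square)
    have "e * ((1 - C * q / e) * (1 - D * q / e) * F e) = (1 - C * q / e) * (1 - D * q / e) * (e * F e)"
      by (simp only: ac_simps)
    also have "\<dots> = - (q * (1 - C * D * q / e) * F (e / q))"
      unfolding F using 2 3 by algebra
    finally have "e * ((1 - C * q / e) * (1 - D * q / e) * F e) = - (q * (1 - C * D * q / e) * F (e / q))" .
    moreover have solve: "X = - (q / e) * (w / (u * v)) * Y"
      if "e * (u * v * X) = - (q * w * Y)" "e \<noteq> 0" "u \<noteq> 0" "v \<noteq> 0" for u v w X Y
      using that by (simp add: field_simps)
    ultimately have "F e = - (q / e) * ((1 - C * D * q / e) / ((1 - C * q / e) * (1 - D * q / e))) * F (e / q)"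
      using solve[OF _ e0 nz] by blast
    moreover have "q / e = q ^ Suc N / a"
      by (simp add: e_def b_def)
    ultimately show ?thesis
      unfolding bS using Cb[of N] Db[of N] CDb[of N] by (simp only: e_def)
  qed
  have iter: "F a = W N * Q N * F (b N)" for N
  proof (induction N)
    case 0
    then show ?case by (simp add: W_def Q_def b_def)
  next
    case (Suc N)
    have "Q (Suc N) = Q N * ((1 - C * D * q / a * q ^ N)
      / ((1 - C * q / a * q ^ N) * (1 - D * q / a * q ^ N)))"
      by (simp add: Q_def qpoch_Suc)
    moreover have "W (Suc N) = W N * - (q ^ Suc N / a)"
      by (simp add: W_def)
    ultimately show ?case
      using Suc step[of N] by (simp only: ac_simps)
  qed
  have Qlim: "Q \<longlonglongrightarrow> qpoch_inf q (C * D * q / a) / (qpoch_inf q (C * q / a) * qpoch_inf q (D * q / a))"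
    unfolding Q_def
    by (intro tendsto_intros qpoch_tendsto_qpoch_inf q1) (simp add: qpoch_inf_nonzero q1 C D)
  have "(\<lambda>N. W N * (q / b N * L * S (1 / b N))) \<longlonglongrightarrow> 0"
  proof -
    define R where "R = norm C + norm D + norm (1 / a)"
    have "\<exists>B. \<forall>N. norm (S (1 / b N)) \<le> B"
    proof (rule vwp_sum_bounded[OF C D, of R])
      fix B
      assume *: "\<And>C' D' x m n. norm C' \<le> R \<Longrightarrow> norm D' \<le> R \<Longrightarrow> norm x \<le> R \<Longrightarrow>
        C' * x * q = C * q / a * q ^ m \<Longrightarrow> D' * x * q = D * q / a * q ^ n \<Longrightarrow>
        summable (vwp_term q C' D' x) \<and> norm (\<Sum>k. vwp_term q C' D' x k) \<le> B"
      have "norm (S (1 / b N)) \<le> B" for N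
      proof -
        have "norm (1 / b N) \<le> norm (1 / a)"
          using norm_shift_le[OF q1, of "1 / a" N] by (simp add: b_def)
        then have "norm C \<le> R" "norm D \<le> R" "norm (1 / b N) \<le> R"
          by (simp_all add: R_def add_increasing add_increasing2)
        moreover have "C * (1 / b N) * q = C * q / a * q ^ N" "D * (1 / b N) * q = D * q / a * q ^ N"
          by (simp_all add: b_def)
        ultimately show ?thesis
          unfolding S_def using * by blast
      qed
      then show ?thesis by blast
    qed
    then obtain B where B: "norm (S (1 / b N)) \<le> B" for N
      by blast
    define E where "E = exp (1 / (norm a * (1 - norm q)))"
    have E: "norm (W N) \<le> E" for N
      unfolding W_def E_def by (rule theta_prod_bounded) simp
    have "norm (W N * (q / b N * L * S (1 / b N))) \<le> E * (norm (q / a) * norm q ^ N * norm L * B)" for N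
    proof -
      have "q / b N = q / a * q ^ N"
        by (simp add: b_def)
      then show ?thesis
        unfolding norm_mult using E B by (intro mult_mono) (auto simp: norm_mult norm_power norm_divide E_def)
    qed
    moreover have "(\<lambda>N. E * (norm (q / a) * norm q ^ N * norm L * B)) \<longlonglongrightarrow> E * (norm (q / a) * 0 * norm L * B)"
      using q1 by (intro tendsto_intros LIMSEQ_power_zero) auto
    then have "(\<lambda>N. E * (norm (q / a) * norm q ^ N * norm L * B)) \<longlonglongrightarrow> 0"
      by simp
    ultimately show ?thesis
      by (rule Lim_null_comparison[OF always_eventually[OF allI]])
  qed
  moreover have "(\<lambda>N. W N * \<Phi> (b N)) \<longlonglongrightarrow> qpoch_inf q a * qpoch_inf q (q / a)"
    unfolding W_def \<Phi>_def b_def by (rule phi_limit[OF q0 a])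
  ultimately have "(\<lambda>N. W N * \<Phi> (b N) - W N * (q / b N * L * S (1 / b N)))
      \<longlonglongrightarrow> qpoch_inf q a * qpoch_inf q (q / a) - 0"
    by (intro tendsto_diff)
  then have "(\<lambda>N. W N * F (b N)) \<longlonglongrightarrow> qpoch_inf q a * qpoch_inf q (q / a)"
    by (simp add: F_def \<Phi>_def S_def right_diff_distrib)
  from tendsto_mult[OF this Qlim] have "(\<lambda>N. W N * F (b N) * Q N) \<longlonglongrightarrow> qpoch_inf q a * qpoch_inf q (q / a)
      * (qpoch_inf q (C * D * q / a) / (qpoch_inf q (C * q / a) * qpoch_inf q (D * q / a)))" .
  moreover have "W N * F (b N) * Q N = F a" for N
    by (subst iter[of N]) (rule mult.commute[THEN trans], simp only: ac_simps)
  ultimately have "(\<lambda>N. F a) \<longlonglongrightarrow> qpoch_inf q a * qpoch_inf q (q / a)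
      * (qpoch_inf q (C * D * q / a) / (qpoch_inf q (C * q / a) * qpoch_inf q (D * q / a)))"
    by (rule Lim_transform_eventually[OF _ always_eventually, OF _ allI])
  then have "F a = qpoch_inf q a * qpoch_inf q (q / a)
      * (qpoch_inf q (C * D * q / a) / (qpoch_inf q (C * q / a) * qpoch_inf q (D * q / a)))"
    by (simp add: LIMSEQ_const_iff)
  then show ?thesis
    unfolding F_def L_def by (simp add: diff_eq_eq)
qed

end

section \<open>Summation along diagonals\<close>

text \<open>The product majorant makes the double series absolutely summable, so summing it by columns and by diagonals
gives the same value.\<close>

lemma sums_antidiagonal:
  fixes h :: "nat \<Rightarrow> nat \<Rightarrow> complex" and f g :: "nat \<Rightarrow> real"
  assumes h: "\<And>j m. norm (h j m) \<le> f j * g m"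
    and f: "summable f" "\<And>j. f j \<ge> 0" and g: "summable g" "\<And>m. g m \<ge> 0"
  shows "summable (\<lambda>j. \<Sum>m. h j m)"
    and "(\<lambda>n. \<Sum>j\<le>n. h j (n - j)) sums (\<Sum>j. \<Sum>m. h j m)"
proof -
  have "(\<lambda>(j, m). f j * g m) summable_on UNIV \<times> UNIV"
  proof (rule summable_on_SigmaI)
    fix j
    show "((\<lambda>m. case (j, m) of (j, m) \<Rightarrow> f j * g m) has_sum f j * suminf g) UNIV"
      using f g by (auto intro!: sums_nonneg_imp_has_sum sums_mult summable_sums)
  next
    show "(\<lambda>j. f j * suminf g) summable_on UNIV"
      using f g by (intro summable_nonneg_imp_summable_on summable_mult2 mult_nonneg_nonneg suminf_nonneg)
  qed (use f g in auto)
  moreover have "norm (f j * g m) = f j * g m" for j m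
    using f g by simp
  ultimately have "(\<lambda>x. norm (case x of (j, m) \<Rightarrow> f j * g m)) summable_on UNIV \<times> UNIV"
    by (simp only: case_prod_unfold)
  then have "(\<lambda>x. norm (case x of (j, m) \<Rightarrow> h j m)) summable_on UNIV \<times> UNIV"
    by (rule Infinite_Sum.abs_summable_on_comparison_test) (use h f g in \<open>auto intro: order_trans[OF _ abs_ge_self]\<close>)
  then obtain T where T: "((\<lambda>(j, m). h j m) has_sum T) (UNIV \<times> UNIV)"
    using abs_summable_summable summable_on_def by blast
  have "(h j has_sum (\<Sum>m. h j m)) UNIV" for j
  proof (rule norm_summable_imp_has_sum)
    show s: "summable (\<lambda>m. norm (h j m))"
      by (rule summable_comparison_test'[OF summable_mult[OF g(1), of "f j"], of 0]) (use h in simp)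
    show "h j sums (\<Sum>m. h j m)"
      by (rule summable_sums[OF summable_norm_cancel[OF s]])
  qed
  then have "((\<lambda>j. \<Sum>m. h j m) has_sum T) UNIV"
    by (intro has_sum_SigmaD[OF T]) simp
  then have cols: "(\<lambda>j. \<Sum>m. h j m) sums T"
    by (rule has_sum_imp_sums)
  then show "summable (\<lambda>j. \<Sum>m. h j m)"
    by (rule sums_summable)
  have "((\<lambda>(n, j). h j (n - j)) has_sum T) (Sigma UNIV (\<lambda>n. {..n}))"
    using T
    by (rule has_sum_reindex_bij_witness[of _ "\<lambda>(n, j). (j, n - j)" "\<lambda>(j, m). (j + m, j)", THEN iffD1, rotated -1])
       auto
  then have "((\<lambda>n. \<Sum>j\<le>n. h j (n - j)) has_sum T) UNIV"
    by (rule has_sum_SigmaD) auto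
  then have "(\<lambda>n. \<Sum>j\<le>n. h j (n - j)) sums T"
    by (rule has_sum_imp_sums)
  then show "(\<lambda>n. \<Sum>j\<le>n. h j (n - j)) sums (\<Sum>j. \<Sum>m. h j m)"
    using cols by (simp add: sums_iff)
qed

section \<open>The series of the theorem\<close>

lemma qregularI:
  assumes "q \<noteq> 0" "x \<notin> range (\<lambda>m::nat. q powi (- int m))"
  shows "qregular q x"
  unfolding qregular_def
proof (intro allI notI)
  fix m assume "x * q ^ m = 1"
  then have "x = q powi (- int m)"
    using assms(1) by (simp add: power_int_minus field_simps)
  then show False
    using assms(2) by blast
qed

text \<open>Distributing \<open>(cd)\<^sup>k q^(2nk)\<close> over the two numerator factors turns \<open>(q\<^sup>1\<^sup>-\<^sup>n/c;q)\<^sub>k\<close> into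
\<open>(cq\<^sup>n - q)\<dots>(cq\<^sup>n - q\<^sup>k)\<close>, so the inner sum depends on \<open>n\<close> only through \<open>cq\<^sup>n\<close> and \<open>dq\<^sup>n\<close>.\<close>

lemma inner_term_eq_vwp_term:
  assumes "q \<noteq> 0" "a \<noteq> 0" "c \<noteq> 0" "d \<noteq> 0"
  shows "inner_term q a c d n = vwp_term q (c * q ^ n) (d * q ^ n) (1 / a)"
proof
  fix k
  have sh: "shifted_prod q (e * q ^ n) k = qpoch q (q powi (1 - int n) / e) k * (e * q ^ n) ^ k"
    if "e \<noteq> 0" for e
  proof -
    have "e * q ^ n - q ^ Suc i = (1 - q powi (1 - int n) / e * q ^ i) * (e * q ^ n)" for i
      using that assms(1) by (simp add: power_int_diff field_simps)
    then show ?thesis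
      by (simp add: shifted_prod_def qpoch_def prod.distrib)
  qed
  have pw: "(c * q ^ n) ^ k * (d * q ^ n) ^ k * (1 / a) ^ (2 * k) = q ^ (2 * n * k) * (c * d / a\<^sup>2) ^ k"
  proof -
    have "2 * n * k = n * k + n * k" "2 * k = k + k"
      by simp_all
    then show ?thesis
      by (simp only: power_add power_mult power_mult_distrib power_divide power2_eq_square power_one)
         (simp add: field_simps)
  qed
  have q: "q ^ (k\<^sup>2 + 2 * n * k + 2 * k) = q ^ (2 * n * k) * q ^ (k\<^sup>2 + 2 * k)"
    by (simp add: power_add)
  have den: "c * q ^ n * (1 / a) * q = c * q ^ (n + 1) / a" "d * q ^ n * (1 / a) * q = d * q ^ (n + 1) / a"
    by simp_all
  define u v w where "u = qpoch q (q powi (1 - int n) / c) k" and "v = qpoch q (q powi (1 - int n) / d) k"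
    and "w = qpoch q (c * q ^ (n + 1) / a) (Suc k) * qpoch q (d * q ^ (n + 1) / a) (Suc k)"
  have "vwp_term q (c * q ^ n) (d * q ^ n) (1 / a) k
     = u * v * ((c * q ^ n) ^ k * (d * q ^ n) ^ k * (1 / a) ^ (2 * k)) * q ^ (k\<^sup>2 + 2 * k)
         * (1 - q ^ (2 * k + 2) / a) / w"
    unfolding vwp_term_def sh[OF assms(3)] sh[OF assms(4)] den w_def[symmetric] u_def[symmetric] v_def[symmetric]
    by (simp only: ac_simps mult_1_left times_divide_eq_left times_divide_eq_right)
  also have "\<dots> = inner_term q a c d n k"
    unfolding pw by (simp add: inner_term_def qpochs_def q u_def v_def w_def)
  finally show "inner_term q a c d n k = vwp_term q (c * q ^ n) (d * q ^ n) (1 / a) k" ..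
qed

lemma inverse_qpoch_mult_bounded:
  assumes "norm q < 1" "qregular q x" "qregular q y"
  obtains K where "K > 0" "\<And>n. norm (inverse (qpoch q x n * qpoch q y n)) \<le> K"
proof -
  have "convergent (\<lambda>n. inverse (qpoch q x n * qpoch q y n))"
    using tendsto_inverse[OF tendsto_mult[OF qpoch_tendsto_qpoch_inf[OF assms(1)] qpoch_tendsto_qpoch_inf[OF assms(1)]]]
      qpoch_inf_nonzero[OF assms(1)] assms(2,3)
    by (fastforce simp: convergent_def)
  then show thesis
    using that by (meson Bseq_def convergent_imp_Bseq)
qed

lemma summable_gauss_Bseq:
  fixes q b :: complex
  assumes "norm q < 1" and "Bseq u"
  shows "summable (\<lambda>n. b ^ n * q ^ n\<^sup>2 * u n)"
proof -
  obtain K where K: "K > 0" "\<And>n. norm (u n) \<le> K"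
    using assms(2) by (auto simp: Bseq_def)
  show ?thesis
  proof (rule summable_comparison_test')
    show "summable (\<lambda>n. norm b ^ n * norm q ^ n\<^sup>2 * K)"
      by (intro summable_mult2 summable_power_mult_gauss assms) simp
    show "norm (b ^ n * q ^ n\<^sup>2 * u n) \<le> norm b ^ n * norm q ^ n\<^sup>2 * K" for n
      using K by (auto simp: norm_mult norm_power intro!: mult_left_mono)
  qed
qed

lemma summable_rhs1_term:
  assumes "norm q < 1" "qregular q b" "qregular q (c * d * q / a)"
  shows "summable (rhs1_term q a b c d)"
proof -
  note lim = qpoch_tendsto_qpoch_inf[OF assms(1)] and nz = qpoch_inf_nonzero[OF assms(1)]
  define u where "u n = qpoch q c n * qpoch q d n * qpoch q (c * q / a) n * qpoch q (d * q / a) n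
    / (qpoch q q n * qpoch q b n * qpoch q (c * d * q / a) (2 * n))" for n
  have "(\<lambda>n. qpoch q (c * d * q / a) (2 * n)) \<longlonglongrightarrow> qpoch_inf q (c * d * q / a)"
    by (rule filterlim_compose[OF lim filterlim_subseq]) (simp add: strict_mono_def)
  then have "u \<longlonglongrightarrow> qpoch_inf q c * qpoch_inf q d * qpoch_inf q (c * q / a) * qpoch_inf q (d * q / a)
    / (qpoch_inf q q * qpoch_inf q b * qpoch_inf q (c * d * q / a))"
    unfolding u_def using nz[OF qregular_base[OF assms(1)]] nz[OF assms(2)] nz[OF assms(3)]
    by (intro tendsto_intros lim) simp_all
  then have "Bseq u"
    by (intro convergent_imp_Bseq) (auto simp: convergent_def)
  then have "summable (\<lambda>n. b ^ n * q ^ n\<^sup>2 * u n)"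
    by (rule summable_gauss_Bseq[OF assms(1)])
  moreover have "b ^ n * q ^ n\<^sup>2 * u n = rhs1_term q a b c d n" for n
    by (simp add: u_def rhs1_term_def qpochs_def mult_ac)
  ultimately show ?thesis
    by simp
qed

lemma summable_inner_and_rhs2_term:
  assumes "q \<noteq> 0" "norm q < 1" "a \<noteq> 0" "c \<noteq> 0" "d \<noteq> 0"
    and b: "qregular q b" and cq: "qregular q (c * q / a)" and dq: "qregular q (d * q / a)"
  shows "summable (inner_term q a c d n)" and "summable (rhs2_term q a b c d)"
proof -
  define R where "R = norm c + norm d + norm (1 / a)"
  have "\<exists>B. \<forall>n. summable (inner_term q a c d n) \<and> norm (\<Sum>k. inner_term q a c d n k) \<le> B"
  proof (rule vwp_sum_bounded[OF assms(2) cq dq, of R])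
    fix B
    assume *: "\<And>C D x m n. norm C \<le> R \<Longrightarrow> norm D \<le> R \<Longrightarrow> norm x \<le> R \<Longrightarrow>
      C * x * q = c * q / a * q ^ m \<Longrightarrow> D * x * q = d * q / a * q ^ n \<Longrightarrow>
      summable (vwp_term q C D x) \<and> norm (\<Sum>k. vwp_term q C D x k) \<le> B"
    have "norm (c * q ^ n) \<le> R" "norm (d * q ^ n) \<le> R" "norm (1 / a) \<le> R" for n
      using norm_shift_le[OF assms(2), of c n] norm_shift_le[OF assms(2), of d n]
        norm_ge_zero[of c] norm_ge_zero[of d] norm_ge_zero[of "1 / a"]
      unfolding R_def by linarith+
    then have "summable (inner_term q a c d n) \<and> norm (\<Sum>k. inner_term q a c d n k) \<le> B" for n
      unfolding inner_term_eq_vwp_term[OF assms(1,3,4,5)] by (intro *[of _ _ _ n n]) simp_all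
    then show ?thesis by blast
  qed
  then obtain B where B: "\<And>n. summable (inner_term q a c d n)" "\<And>n. norm (\<Sum>k. inner_term q a c d n k) \<le> B"
    by blast
  then show "summable (inner_term q a c d n)" by blast
  obtain K where K: "K > 0" "\<And>n. norm (inverse (qpoch q q n * qpoch q b n)) \<le> K"
    using inverse_qpoch_mult_bounded[OF assms(2) qregular_base[OF assms(2)] b] by blast
  have "norm (inverse (qpoch q q n * qpoch q b n) * (\<Sum>k. inner_term q a c d n k)) \<le> K * B" for n
    unfolding norm_mult[of "inverse _"] using K B by (intro mult_mono) auto
  then have "Bseq (\<lambda>n. inverse (qpoch q q n * qpoch q b n) * (\<Sum>k. inner_term q a c d n k))"
    by (rule BseqI')
  then have "summable (\<lambda>n. b ^ n * q ^ n\<^sup>2 * (inverse (qpoch q q n * qpoch q b n) * (\<Sum>k. inner_term q a c d n k)))"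
    by (rule summable_gauss_Bseq[OF assms(2)])
  then show "summable (rhs2_term q a b c d)"
    by (simp add: rhs2_term_def[abs_def] qpochs_def field_simps)
qed

section \<open>The transformation formula\<close>

theorem theorem1p1:
  fixes q a b c d :: complex
  assumes "0 < norm q" and "norm q < 1"
    and "a \<noteq> 0" and "c \<noteq> 0" and "d \<noteq> 0"
    and "\<forall>x\<in>{a, b, c * q / a, d * q / a, c * d * q / a}. x \<notin> range (\<lambda>m::nat. q powi (- int m))"
  shows "summable (lhs_term q a b c d)
    \<and> summable (rhs1_term q a b c d)
    \<and> (\<forall>n. summable (inner_term q a c d n))
    \<and> summable (rhs2_term q a b c d)
    \<and> (\<Sum>n. lhs_term q a b c d n) =
        qpochs_inf q [q / a, c * d * q / a] / qpochs_inf q [c * q / a, d * q / a]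
          * (\<Sum>n. rhs1_term q a b c d n)
        + q / a * (qpochs_inf q [c, d] / qpochs_inf q [q, a]) * (\<Sum>n. rhs2_term q a b c d n)"
proof -
  have q0: "q \<noteq> 0" and q1: "norm q < 1"
    using assms(1,2) by auto
  have ra: "qregular q a" and rb: "qregular q b" and rc: "qregular q (c * q / a)"
    and rd: "qregular q (d * q / a)" and rcd: "qregular q (c * d * q / a)"
    using assms(6) by (auto intro!: qregularI[OF q0])
  note rq = qregular_base[OF q1]
  note nz = qpoch_nonzero[OF rq] qpoch_nonzero[OF ra] qpoch_nonzero[OF rb]
  note nzi = qpoch_inf_nonzero[OF q1]
  define A where "A j = b ^ j * q ^ (j * (j - 1)) / (qpoch q q j * qpoch q b j)" for j
  define h where "h j m = A j * (qpoch q c (j + m) * qpoch q d (j + m) * q ^ (j + m) / (qpoch q q m * qpoch q a m))" for j m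
  define K1 where "K1 = qpochs_inf q [q / a, c * d * q / a] / qpochs_inf q [c * q / a, d * q / a]"
  define K2 where "K2 = q / a * (qpochs_inf q [c, d] / qpochs_inf q [q, a])"

  \<comment> \<open>The finite q-Vandermonde sum presents each summand on the left as a sum over a diagonal of \<open>h\<close>.\<close>
  have diag: "lhs_term q a b c d n = (\<Sum>j\<le>n. h j (n - j))" for n
  proof -
    have "lhs_term q a b c d n = qpoch q c n * qpoch q d n * q ^ n
       * (qpoch q (a * b * q powi (int n - 1)) n / (qpoch q q n * qpoch q a n * qpoch q b n))"
      by (simp add: lhs_term_def qpochs_def mult_ac)
    also have "\<dots> = (\<Sum>j\<le>n. h j (n - j))"
      unfolding q_vandermonde[OF q0 q1 ra rb] sum_distrib_left
      by (rule sum.cong) (simp_all add: h_def A_def mult_ac)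
    finally show ?thesis .
  qed

  have A_q: "A j * q ^ j = b ^ j * q ^ j\<^sup>2 / (qpoch q q j * qpoch q b j)" for j
  proof -
    have "j * (j - 1) + j = j\<^sup>2"
      by (cases j) (simp_all add: power2_eq_square)
    then have "q ^ (j * (j - 1)) * q ^ j = q ^ j\<^sup>2"
      by (simp flip: power_add)
    then show ?thesis
      by (simp add: A_def mult.assoc)
  qed

  \<comment> \<open>Each column of \<open>h\<close> is a multiple of a \<open>2\<phi>1\<close> series with parameters \<open>cq\<^sup>j, dq\<^sup>j\<close>; its two parts are the
      \<open>j\<close>-th summands on the right.\<close>
  have col: "(\<Sum>m. h j m) = K1 * rhs1_term q a b c d j + K2 * rhs2_term q a b c d j" for j
  proof -
    define C D where "C = c * q ^ j" and "D = d * q ^ j"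
    define P where "P = A j * q ^ j * (qpoch q c j * qpoch q d j) / qpoch_inf q a"
    have "h j m = P * phi_term q C D a m" for m
      using nz(2)[of m] nzi[OF ra] nzi[OF qregular_shift[OF ra, of m]]
      unfolding h_def P_def phi_term_def qpoch_add C_def D_def qpoch_inf_split[OF q1, of a m]
      by (simp add: power_add mult_ac)
    then have "(\<Sum>m. h j m) = P * (\<Sum>m. phi_term q C D a m)"
      using suminf_mult[OF summable_norm_cancel[OF summable_norm_phi[OF q1]]] by simp
    moreover have rC: "qregular q (C * q / a)" and rD: "qregular q (D * q / a)"
      using qregular_shift[OF rc, of j] qregular_shift[OF rd, of j] by (simp_all add: C_def D_def mult_ac)
    note nonterminating_q_vandermonde[OF q1 q0 assms(3) rC rD]
    moreover have "P * (qpoch_inf q a * qpoch_inf q (q / a) * qpoch_inf q (C * D * q / a)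
        / (qpoch_inf q (C * q / a) * qpoch_inf q (D * q / a))) = K1 * rhs1_term q a b c d j"
    proof -
      have 1: "qpoch_inf q (c * q / a) = qpoch q (c * q / a) j * qpoch_inf q (C * q / a)"
        using qpoch_inf_split[OF q1, of "c * q / a" j] by (simp add: C_def mult_ac)
      have 2: "qpoch_inf q (d * q / a) = qpoch q (d * q / a) j * qpoch_inf q (D * q / a)"
        using qpoch_inf_split[OF q1, of "d * q / a" j] by (simp add: D_def mult_ac)
      have "c * d * q / a * q ^ (2 * j) = C * D * q / a"
        unfolding C_def D_def mult_2 power_add by simp
      then have 3: "qpoch_inf q (c * d * q / a) = qpoch q (c * d * q / a) (2 * j) * qpoch_inf q (C * D * q / a)"
        by (metis qpoch_inf_split[OF q1])
      have cancel: "p * (k * l) / i * (i * s * t / (u * v)) = s * (w * t) / (x * u * (y * v)) * (k * l * x * y * p / w)"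
        if "i \<noteq> 0" "w \<noteq> 0" "x \<noteq> 0" "y \<noteq> 0" for p k l i s t u v w x y :: complex
        using that by (simp add: field_simps)
      have "rhs1_term q a b c d j = qpoch q c j * qpoch q d j * qpoch q (c * q / a) j * qpoch q (d * q / a) j
          * (A j * q ^ j) / qpoch q (c * d * q / a) (2 * j)"
        unfolding A_q rhs1_term_def qpochs_def by (simp add: mult_ac)
      then show ?thesis
        unfolding P_def K1_def qpochs_inf_def
        using cancel[OF nzi[OF ra] qpoch_nonzero[OF rcd] qpoch_nonzero[OF rc] qpoch_nonzero[OF rd]]
        by (simp add: 1 2 3)
    qed
    moreover have "P * (q / a * (qpoch_inf q C * qpoch_inf q D / qpoch_inf q q) * (\<Sum>k. vwp_term q C D (1 / a) k))
       = K2 * rhs2_term q a b c d j"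
      unfolding P_def K2_def rhs2_term_def qpochs_inf_def qpochs_def A_q
        inner_term_eq_vwp_term[OF q0 assms(3,4,5)] C_def D_def
      by (simp add: qpoch_inf_split[OF q1, of c j] qpoch_inf_split[OF q1, of d j] mult_ac)
    ultimately show ?thesis
      by (simp only: distrib_left)
  qed

  obtain K where K: "K > 0" "\<And>n. norm (inverse (qpoch q q n * qpoch q b n)) \<le> K"
    using inverse_qpoch_mult_bounded[OF q1 rq rb] by blast
  obtain L where L: "L > 0" "\<And>n. norm (inverse (qpoch q q n * qpoch q a n)) \<le> L"
    using inverse_qpoch_mult_bounded[OF q1 rq ra] by blast
  define E where "E = exp (norm c / (1 - norm q)) * exp (norm d / (1 - norm q))"
  have bound: "norm (h j m) \<le> (norm b ^ j * norm q ^ j\<^sup>2 * K) * (E * norm q ^ m * L)" for j m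
  proof -
    have "h j m = (b ^ j * q ^ j\<^sup>2 * inverse (qpoch q q j * qpoch q b j))
      * (qpoch q c (j + m) * qpoch q d (j + m) * q ^ m * inverse (qpoch q q m * qpoch q a m))"
    proof -
      have "h j m = (A j * q ^ j) * (qpoch q c (j + m) * qpoch q d (j + m) * q ^ m / (qpoch q q m * qpoch q a m))"
        by (simp add: h_def power_add mult_ac)
      then show ?thesis
        unfolding A_q by (simp add: divide_inverse mult_ac)
    qed
    also have "norm \<dots> \<le> (norm b ^ j * norm q ^ j\<^sup>2 * K) * (E * norm q ^ m * L)"
      unfolding norm_mult[of _ "inverse _"] norm_mult[of "_ * inverse _"] norm_mult[of _ "q ^ _"] 
        norm_mult[of "qpoch q c _"] norm_power E_def
      using K L by (intro mult_mono norm_qpoch_le q1) auto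
    finally show ?thesis .
  qed
  have sf: "summable (\<lambda>j. norm b ^ j * norm q ^ j\<^sup>2 * K)" "summable (\<lambda>m. E * norm q ^ m * L)"
    using q1 by (auto intro!: summable_mult summable_mult2 summable_geometric summable_power_mult_gauss)
  have "(\<lambda>n. \<Sum>j\<le>n. h j (n - j)) sums (\<Sum>j. \<Sum>m. h j m)"
    by (rule sums_antidiagonal(2)[OF bound sf(1) _ sf(2)]) (use K L in \<open>auto simp: E_def\<close>)
  then have lhs: "lhs_term q a b c d sums (\<Sum>j. K1 * rhs1_term q a b c d j + K2 * rhs2_term q a b c d j)"
    unfolding col by (simp add: diag[abs_def])
  note s1 = summable_rhs1_term[OF q1 rb rcd]
  note s2 = summable_inner_and_rhs2_term[OF q0 q1 assms(3,4,5) rb rc rd]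
  have "(\<Sum>j. K1 * rhs1_term q a b c d j + K2 * rhs2_term q a b c d j)
    = K1 * (\<Sum>j. rhs1_term q a b c d j) + K2 * (\<Sum>j. rhs2_term q a b c d j)"
    by (intro sums_unique[symmetric] sums_add sums_mult summable_sums s1 s2)
  with lhs s1 s2 show ?thesis
    unfolding K1_def K2_def by (simp add: sums_iff)
qed

end
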